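(* Let $\mathcal{X}_h=(X,U,f,h,Y)$ be an external system, let $\pi_{hist}$ be a feasible policy over its attainable histories, let $(Y^{<\mathbb{N}},Y,\phi_{\tilde Y},(),\pi,U^\xi)$ be the restriction of the history ITS by $\pi_{hist}$, and let $\bar\pi$ be a minimal sufficient refinement of $\pi$. Then the quotient of $(Y^{<\mathbb{N}},Y,\phi_{\tilde Y},())$ by $\bar\pi$ is a minimal ITS that supports $\pi_{hist}$. Furthermore, this minimal ITS is unique (any two labelings whose quotients are minimal ITSs supporting $\pi_{hist}$ induce the same partition of $Y^{<\mathbb{N}}$).
   Context: External system: $\mathcal{X}_h=(X,U,f,h,Y)$ consists of a state set $X$, an action set $U$, a transition function $f:X\times U\to X$, an observation set $Y$ and a sensor mapping $h:X\to Y$. Histories: $\mathcal{I}_{hist}$ is the set of finite alternating sequences $\eta=(y_1,u_1,y_2,\dots,u_{N-1},y_N)$ with $y_i\in Y$, $u_i\in U$, including the empty history $()$ (the action preceding $y_1$ is a null action, so the first step appends just $y_1$). A history $\eta$ is attainable if it is empty or there is $x_1\in X$ such that, with $x_{k+1}=f(x_k,u_k)$, one has $y_k=h(x_k)$ for all $k\le N$. $\mathcal{I}_{hist}^{\mathcal{X}_h}$ denotes the set of attainable histories. Policies and feasibility: a task is a function $\kappa_{task}:\mathcal{I}_{hist}\to\{0,1\}$. A policy over histories is a function $\pi_{hist}:\mathcal{I}_{hist}^{\mathcal{X}_h}\to U$. It is feasible if for every $x_1\in X$ the history $(h(x_1),u_1,h(x_2),\dots,u_{N-1},h(x_N))$ generated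 by $u_k=\pi_{hist}(h(x_1),u_1,\dots,h(x_k))$, $x_{k+1}=f(x_k,u_k)$, lies in $\kappa_{task}^{-1}(1)$ for some $N$ (which may depend on $x_1$). Restriction by $\pi_{hist}$: $Y^{<\mathbb{N}}$ is the set of finite sequences over $Y$, $\phi_{\tilde Y}(\tilde y,y)=\tilde y^\frown y$ (concatenation), $U^\xi=U\cup\{\xi\}$ with $\xi\notin U$ a dummy label. The labeling $\pi:Y^{<\mathbb{N}}\to U^\xi$ is defined as follows: $\pi(())=\pi_{hist}(())$; for $\tilde y=(y_1,\dots,y_N)$, $N\ge1$, form the history $\eta=(y_1,u_1,\dots,u_{N-1},y_N)$ with $u_k=\pi_{hist}(y_1,u_1,\dots,y_k)$ as long as the prefixes $(y_1,u_1,\dots,y_k)$ are attainable; if all prefixes including $\eta$ itself are attainable put $\pi(\tilde y)=\pi_{hist}(\eta)$, otherwise put $\pi(\tilde y)=\xi$. ITS: an information transition system (ITS) $S=(\mathcal{I},Y,\phi,\iota_0)$ consists of a state set $\mathcal{I}$, the edge-label set $Y$, a function $\phi:\mathcal{I}\times Y\to\mathcal{I}$ and an initial state $\iota_0$. For $\mu:\mathcal{I}\to U^\xi$ define $\Pi(S,\mu):Y^{<\mathbb{N}}\to U^\xi$ by $\Pi(S,\mu)(y_1,\dots,y_N)=\mu(\iota_N)$, where $\iota_i=\phi(\iota_{i-1},y_i)$ (for $N=0$ the value is $\mu(\iota_0)$). $S$ supports $\pi_{hist}$ if there is $\mu:\mathcal{I}\to U^\xi$ with $\Pi(S,\mu)=\pi$.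 Labelings: for labeling functions $\kappa,\kappa'$ on the same set, $\kappa'\succeq\kappa$ ($\kappa'$ is a refinement of $\kappa$) means every fiber of $\kappa'$ is contained in a fiber of $\kappa$; the refinement is strict if moreover $\kappa\not\succeq\kappa'$. A labeling $\kappa$ of $Y^{<\mathbb{N}}$ is sufficient if $\kappa(\tilde y)=\kappa(\tilde y')$ implies $\kappa(\tilde y^\frown y)=\kappa(\tilde y'^\frown y)$ for all $y\in Y$. For sufficient $\kappa$, the quotient of $(Y^{<\mathbb{N}},Y,\phi_{\tilde Y},())$ by $\kappa$ is the ITS whose states are the fibers $[\tilde y]_\kappa$ of $\kappa$, with transitions $([\tilde y]_\kappa,y)\mapsto[\tilde y^\frown y]_\kappa$ and initial state $[()]_\kappa$. A minimal sufficient refinement of $\pi$ is a sufficient labeling $\bar\pi\succeq\pi$ such that no sufficient labeling $\kappa\succeq\pi$ is strictly refined by $\bar\pi$. A minimal ITS supporting $\pi_{hist}$ is a quotient of $(Y^{<\mathbb{N}},Y,\phi_{\tilde Y},())$ by a sufficient labeling $\kappa$ that supports $\pi_{hist}$, such that no sufficient labeling strictly refined by $\kappa$ has a quotient supporting $\pi_{hist}$. *)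

theory Defs
  imports Main
begin

text \<open>State, action and observation sets are types. The transition
  function is curried.\<close>

record ('x, 'u, 'y) external_system =
  transition :: "'x \<Rightarrow> 'u \<Rightarrow> 'x"
  sensor :: "'x \<Rightarrow> 'y"


subsection \<open>Histories\<close>

text \<open>\<open>Hist y1 [(u1, y2), (u2, y3), \<dots>]\<close> is the alternating sequence
  \<open>(y1, u1, y2, u2, y3, \<dots>)\<close>, so that the type consists of exactly the finite
  histories, including the empty one.\<close>

datatype ('u, 'y) history = Empty | Hist 'y "('u \<times> 'y) list"

text \<open>Appending an observation to the empty history drops the (null) action.\<close>

fun extend :: "('u, 'y) history \<Rightarrow> 'u \<Rightarrow> 'y \<Rightarrow> ('u, 'y) history" where
  "extend Empty u y = Hist y []"
| "extend (Hist y0 s) u y = Hist y0 (s @ [(u, y)])"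

fun consistent_from ::
  "('x, 'u, 'y) external_system \<Rightarrow> 'x \<Rightarrow> ('u \<times> 'y) list \<Rightarrow> bool" where
  "consistent_from sys x [] \<longleftrightarrow> True"
| "consistent_from sys x ((u, y) # s) \<longleftrightarrow>
     sensor sys (transition sys x u) = y \<and> consistent_from sys (transition sys x u) s"

fun attainable :: "('x, 'u, 'y) external_system \<Rightarrow> ('u, 'y) history \<Rightarrow> bool" where
  "attainable sys Empty \<longleftrightarrow> True"
| "attainable sys (Hist y s) \<longleftrightarrow> (\<exists>x. sensor sys x = y \<and> consistent_from sys x s)"


subsection \<open>Policies over histories\<close>

text \<open>A policy is defined on attainable histories only. It is represented by a total
  function; \<open>feasible\<close> and \<open>restriction\<close> below never depend on its values at
  unattainable histories.\<close>

type_synonym ('u, 'y) policy = "('u, 'y) history \<Rightarrow> 'u"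

text \<open>\<open>rollout sys p x n\<close> is the history with \<open>n + 1\<close> observations generated
  from the state \<open>x\<close> under \<open>p\<close>, together with the state reached.\<close>

fun rollout ::
  "('x, 'u, 'y) external_system \<Rightarrow> ('u, 'y) policy \<Rightarrow> 'x \<Rightarrow> nat \<Rightarrow> ('u, 'y) history \<times> 'x"
where
  "rollout sys p x 0 = (Hist (sensor sys x) [], x)"
| "rollout sys p x (Suc n) =
     (let (\<eta>, z) = rollout sys p x n; z' = transition sys z (p \<eta>)
      in (extend \<eta> (p \<eta>) (sensor sys z'), z'))"

text \<open>A task is a predicate on histories: \<open>True\<close> and \<open>False\<close> play the roles of
  1 and 0.\<close>

definition feasible ::
  "('x, 'u, 'y) external_system \<Rightarrow> (('u, 'y) history \<Rightarrow> bool) \<Rightarrow> ('u, 'y) policy \<Rightarrow> bool"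
where
  "feasible sys task p \<longleftrightarrow> (\<forall>x. \<exists>n. task (fst (rollout sys p x n)))"


subsection \<open>Restriction by a policy\<close>

text \<open>\<open>induced_history sys p \<eta> ys\<close> extends \<open>\<eta>\<close> by the observations \<open>ys\<close> and the
  actions prescribed by \<open>p\<close>; it is \<open>None\<close> as soon as an unattainable history
  occurs, the final one included.\<close>

fun induced_history ::
  "('x, 'u, 'y) external_system \<Rightarrow> ('u, 'y) policy \<Rightarrow> ('u, 'y) history \<Rightarrow> 'y list
     \<Rightarrow> ('u, 'y) history option"
where
  "induced_history sys p \<eta> [] = (if attainable sys \<eta> then Some \<eta> else None)"
| "induced_history sys p \<eta> (y # ys) =
     (if attainable sys \<eta> then induced_history sys p (extend \<eta> (p \<eta>) y) ys else None)"

text \<open>The label set \<open>U \<union> {\<xi>}\<close> is \<^typ>\<open>'u option\<close>, with \<open>None\<close> for the dummy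
  label \<open>\<xi>\<close>.\<close>

definition restriction ::
  "('x, 'u, 'y) external_system \<Rightarrow> ('u, 'y) policy \<Rightarrow> 'y list \<Rightarrow> 'u option"
where
  "restriction sys p ys = map_option p (induced_history sys p Empty ys)"


subsection \<open>Labelings of observation sequences\<close>

definition fiber :: "('y list \<Rightarrow> 'l) \<Rightarrow> 'y list \<Rightarrow> 'y list set" where
  "fiber \<kappa> ys = {zs. \<kappa> zs = \<kappa> ys}"

definition fibers :: "('y list \<Rightarrow> 'l) \<Rightarrow> 'y list set set" where
  "fibers \<kappa> = range (fiber \<kappa>)"

definition refinement :: "('y list \<Rightarrow> 'l) \<Rightarrow> ('y list \<Rightarrow> 'm) \<Rightarrow> bool" where
  "refinement \<kappa>' \<kappa> \<longleftrightarrow> (\<forall>A\<in>fibers \<kappa>'. \<exists>B\<in>fibers \<kappa>. A \<subseteq> B)"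

definition strict_refinement :: "('y list \<Rightarrow> 'l) \<Rightarrow> ('y list \<Rightarrow> 'm) \<Rightarrow> bool" where
  "strict_refinement \<kappa>' \<kappa> \<longleftrightarrow> refinement \<kappa>' \<kappa> \<and> \<not> refinement \<kappa> \<kappa>'"

definition sufficient :: "('y list \<Rightarrow> 'l) \<Rightarrow> bool" where
  "sufficient \<kappa> \<longleftrightarrow>
     (\<forall>ys ys'. \<kappa> ys = \<kappa> ys' \<longrightarrow> (\<forall>y. \<kappa> (ys @ [y]) = \<kappa> (ys' @ [y])))"

text \<open>Type variables cannot be quantified inside a formula. Where ``some labeling'' is
  bound inside a definition below, its labels have type \<^typ>\<open>'y list set\<close>. This is
  no restriction: every labeling, whatever its label type, has the same fibers as the
  labeling of this type that sends each sequence to its own fiber, and refinement,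
  sufficiency and quotients depend on the fibers only.\<close>

lemma fiber_eq_iff: "fiber \<kappa> zs = fiber \<kappa> ys \<longleftrightarrow> \<kappa> zs = \<kappa> ys"
  by (auto simp: fiber_def)

lemma fiber_fiber: "fiber (fiber \<kappa>) = fiber \<kappa>"
proof
  fix ys
  have "fiber (fiber \<kappa>) ys = {zs. fiber \<kappa> zs = fiber \<kappa> ys}"
    by (rule fiber_def)
  also have "\<dots> = {zs. \<kappa> zs = \<kappa> ys}"
    by (simp only: fiber_eq_iff)
  also have "\<dots> = fiber \<kappa> ys"
    by (rule fiber_def[symmetric])
  finally show "fiber (fiber \<kappa>) ys = fiber \<kappa> ys" .
qed

lemma fibers_fiber: "fibers (fiber \<kappa>) = fibers \<kappa>"
  by (simp add: fibers_def fiber_fiber)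

lemma sufficient_fiber: "sufficient (fiber \<kappa>) \<longleftrightarrow> sufficient \<kappa>"
  by (simp add: sufficient_def fiber_eq_iff)

definition minimal_sufficient_refinement ::
  "('y list \<Rightarrow> 'm) \<Rightarrow> ('y list \<Rightarrow> 'l) \<Rightarrow> bool"
where
  "minimal_sufficient_refinement \<pi> \<kappa> \<longleftrightarrow>
     sufficient \<kappa> \<and> refinement \<kappa> \<pi> \<and>
     \<not> (\<exists>\<kappa>' :: 'y list \<Rightarrow> 'y list set.
           sufficient \<kappa>' \<and> refinement \<kappa>' \<pi> \<and> strict_refinement \<kappa> \<kappa>')"


subsection \<open>Information transition systems\<close>

record ('s, 'y) its =
  states :: "'s set"
  step :: "'s \<Rightarrow> 'y \<Rightarrow> 's"
  init :: "'s"

definition is_its :: "('s, 'y) its \<Rightarrow> bool" where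
  "is_its S \<longleftrightarrow> init S \<in> states S \<and> (\<forall>s\<in>states S. \<forall>y. step S s y \<in> states S)"

definition its_output :: "('s, 'y) its \<Rightarrow> ('s \<Rightarrow> 'u option) \<Rightarrow> 'y list \<Rightarrow> 'u option" where
  "its_output S \<mu> ys = \<mu> (foldl (step S) (init S) ys)"

definition supports ::
  "('s, 'y) its \<Rightarrow> ('x, 'u, 'y) external_system \<Rightarrow> ('u, 'y) policy \<Rightarrow> bool"
where
  "supports S sys p \<longleftrightarrow> is_its S \<and> (\<exists>\<mu>. its_output S \<mu> = restriction sys p)"

text \<open>The quotient of the system of all observation sequences (with appending of an
  observation as transition and \<open>[]\<close> as initial state) by a sufficient labeling. Outside
  the state set the transition function is fixed to \<open>undefined\<close>, so that the quotient is
  determined by the partition into fibers.\<close>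

definition quotient_its :: "('y list \<Rightarrow> 'l) \<Rightarrow> ('y list set, 'y) its" where
  "quotient_its \<kappa> =
     \<lparr> states = fibers \<kappa>,
       step = (\<lambda>A y. if A \<in> fibers \<kappa>
                then THE B. \<exists>ys. A = fiber \<kappa> ys \<and> B = fiber \<kappa> (ys @ [y])
                else undefined),
       init = fiber \<kappa> [] \<rparr>"

lemma quotient_fiber: "quotient_its (fiber \<kappa>) = quotient_its \<kappa>"
  unfolding quotient_its_def fibers_fiber fiber_fiber ..

lemma step_quotient:
  assumes "sufficient \<kappa>"
  shows "step (quotient_its \<kappa>) (fiber \<kappa> ys) y = fiber \<kappa> (ys @ [y])"
proof -
  have "fiber \<kappa> (zs @ [y]) = fiber \<kappa> (ys @ [y])" if "fiber \<kappa> ys = fiber \<kappa> zs" for zs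
    using assms that[symmetric] unfolding fiber_eq_iff sufficient_def by blast
  then have "(THE B. \<exists>zs. fiber \<kappa> ys = fiber \<kappa> zs \<and> B = fiber \<kappa> (zs @ [y]))
      = fiber \<kappa> (ys @ [y])"
    by (intro the_equality) blast+
  moreover have "fiber \<kappa> ys \<in> fibers \<kappa>"
    by (simp add: fibers_def)
  ultimately show ?thesis
    by (simp add: quotient_its_def)
qed

lemma is_its_quotient:
  assumes "sufficient \<kappa>"
  shows "is_its (quotient_its \<kappa>)"
proof -
  have st: "states (quotient_its \<kappa>) = range (fiber \<kappa>)"
    by (simp add: quotient_its_def fibers_def)
  have "init (quotient_its \<kappa>) = fiber \<kappa> []"
    by (simp add: quotient_its_def)
  then show ?thesis
    unfolding is_its_def st by (auto simp: step_quotient[OF assms])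
qed

definition minimal_its ::
  "('y list set, 'y) its \<Rightarrow> ('x, 'u, 'y) external_system \<Rightarrow> ('u, 'y) policy \<Rightarrow> bool"
where
  "minimal_its S sys p \<longleftrightarrow>
     (\<exists>\<kappa> :: 'y list \<Rightarrow> 'y list set.
        sufficient \<kappa> \<and> S = quotient_its \<kappa> \<and> supports S sys p \<and>
        \<not> (\<exists>\<kappa>' :: 'y list \<Rightarrow> 'y list set.
              sufficient \<kappa>' \<and> strict_refinement \<kappa> \<kappa>' \<and> supports (quotient_its \<kappa>') sys p))"

end

(* A quotient by a sufficient labeling supports the policy exactly if the labeling refines
   the restriction \<pi>, so minimal supporting quotients are the quotients by minimal
   sufficient refinements of \<pi>.  As in the Myhill-Nerode theorem, the sufficient
   refinements of \<pi> have a coarsest element: identify ys and ys' if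
   \<pi> (ys @ zs) = \<pi> (ys' @ zs) for all zs.  Hence a minimal one has its fibers. *)
theory Submission
  imports Defs "HOL-Library.FuncSet"
begin

text \<open>Every fiber contains the sequence that it is built from, so inclusion between fibers
  amounts to inclusion between the kernels of the labelings, the form that is convenient
  below.\<close>

lemma refinement_iff: "refinement \<kappa>' \<kappa> \<longleftrightarrow> (\<forall>ys zs. \<kappa>' ys = \<kappa>' zs \<longrightarrow> \<kappa> ys = \<kappa> zs)"
proof
  assume ref: "refinement \<kappa>' \<kappa>"
  show "\<forall>ys zs. \<kappa>' ys = \<kappa>' zs \<longrightarrow> \<kappa> ys = \<kappa> zs"
  proof (intro allI impI)
    fix ys zs
    assume eq: "\<kappa>' ys = \<kappa>' zs"
    obtain ws where "fiber \<kappa>' ys \<subseteq> fiber \<kappa> ws"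
      using ref by (auto simp: refinement_def fibers_def)
    moreover have "ys \<in> fiber \<kappa>' ys" "zs \<in> fiber \<kappa>' ys"
      using eq by (simp_all add: fiber_def)
    ultimately have "ys \<in> fiber \<kappa> ws" "zs \<in> fiber \<kappa> ws"
      by blast+
    then show "\<kappa> ys = \<kappa> zs"
      by (simp add: fiber_def)
  qed
next
  assume imp: "\<forall>ys zs. \<kappa>' ys = \<kappa>' zs \<longrightarrow> \<kappa> ys = \<kappa> zs"
  have "fiber \<kappa>' ys \<subseteq> fiber \<kappa> ys" for ys
    unfolding fiber_def by (rule Collect_mono) (rule imp[THEN spec, THEN spec])
  then show "refinement \<kappa>' \<kappa>"
    by (auto simp: refinement_def fibers_def)
qed

lemma refinement_fiber_left: "refinement (fiber \<kappa>') \<kappa> \<longleftrightarrow> refinement \<kappa>' \<kappa>"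
  by (simp add: refinement_def fibers_fiber)

lemma refinement_fiber_right: "refinement \<kappa>' (fiber \<kappa>) \<longleftrightarrow> refinement \<kappa>' \<kappa>"
  by (simp add: refinement_def fibers_fiber)

lemma fibers_eq_if_mutual_refinement:
  assumes "refinement \<kappa> \<kappa>'" "refinement \<kappa>' \<kappa>"
  shows "fibers \<kappa> = fibers \<kappa>'"
proof -
  have "\<kappa> zs = \<kappa> ys \<longleftrightarrow> \<kappa>' zs = \<kappa>' ys" for zs ys
    using assms unfolding refinement_iff by metis
  then have "fiber \<kappa> = fiber \<kappa>'"
    by (simp add: fiber_def fun_eq_iff)
  then show ?thesis
    by (simp add: fibers_def)
qed

text \<open>A sequence is labeled by its whole residual function (the left quotient of \<pi>), so
  that equality of labels is Nerode equivalence.\<close>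

definition nerode :: "('y list \<Rightarrow> 'm) \<Rightarrow> 'y list \<Rightarrow> 'y list \<Rightarrow> 'm" where
  "nerode \<pi> ys = (\<lambda>zs. \<pi> (ys @ zs))"

text \<open>The residual after one more observation \<open>y\<close> is the old residual precomposed
  with \<open>(#) y\<close>, hence determined by the old label.\<close>

lemma sufficient_nerode: "sufficient (nerode \<pi>)"
proof -
  have "nerode \<pi> (ys @ [y]) = (\<lambda>zs. nerode \<pi> ys (y # zs))" for ys y
    by (simp add: nerode_def)
  then show ?thesis
    by (simp add: sufficient_def)
qed

lemma refinement_nerode: "refinement (nerode \<pi>) \<pi>"
proof -
  have "\<pi> ys = nerode \<pi> ys []" for ys
    by (simp add: nerode_def)
  then show ?thesis
    by (simp add: refinement_iff)
qed

lemma sufficient_append: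
  assumes "sufficient \<kappa>" "\<kappa> ys = \<kappa> ys'"
  shows "\<kappa> (ys @ zs) = \<kappa> (ys' @ zs)"
proof (induction zs rule: rev_induct)
  case (snoc z zs)
  then have "\<kappa> ((ys @ zs) @ [z]) = \<kappa> ((ys' @ zs) @ [z])"
    by (rule assms(1)[unfolded sufficient_def, rule_format])
  then show ?case
    by simp
qed (simp add: assms)

text \<open>Sufficiency carries equality of labels along every common suffix, and refinement turns
  it into equality of \<pi>. This makes the Nerode labeling the coarsest one.\<close>

lemma refinement_nerode_if_sufficient:
  assumes "sufficient \<kappa>" "refinement \<kappa> \<pi>"
  shows "refinement \<kappa> (nerode \<pi>)"
  unfolding refinement_iff
proof (intro allI impI)
  fix ys zs
  assume "\<kappa> ys = \<kappa> zs"
  then have "\<kappa> (ys @ ws) = \<kappa> (zs @ ws)" for ws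
    by (rule sufficient_append[OF assms(1)])
  then have "\<pi> (ys @ ws) = \<pi> (zs @ ws)" for ws
    using assms(2) unfolding refinement_iff by blast
  then show "nerode \<pi> ys = nerode \<pi> zs"
    by (simp add: nerode_def)
qed

lemma foldl_quotient:
  assumes "sufficient \<kappa>"
  shows "foldl (step (quotient_its \<kappa>)) (init (quotient_its \<kappa>)) ys = fiber \<kappa> ys"
proof (induction ys rule: rev_induct)
  case Nil
  then show ?case
    by (simp add: quotient_its_def)
next
  case (snoc y ys)
  then show ?case
    by (simp add: step_quotient[OF assms])
qed

text \<open>Reading \<open>ys\<close> in the quotient ends in the state
  \<open>fiber \<kappa> ys\<close>, so a supporting \<open>\<mu>\<close> is a factorization of the
  restriction through \<open>fiber \<kappa>\<close>.\<close>

lemma supports_quotient_iff: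
  assumes "sufficient \<kappa>"
  shows "supports (quotient_its \<kappa>) sys p \<longleftrightarrow> refinement \<kappa> (restriction sys p)"
proof -
  have "supports (quotient_its \<kappa>) sys p \<longleftrightarrow> (\<exists>\<mu>. restriction sys p = \<mu> \<circ> fiber \<kappa>)"
    using is_its_quotient[OF assms]
    by (simp add: supports_def its_output_def foldl_quotient[OF assms] fun_eq_iff eq_commute)
  also have "\<dots> \<longleftrightarrow> refinement (fiber \<kappa>) (restriction sys p)"
    \<comment> \<open>Such a factorization exists iff the restriction is constant on the fibers; the
      values of \<open>\<mu>\<close> at sets that are not fibers are arbitrary.\<close>
    unfolding refinement_iff by (rule function_factors_left[symmetric])
  finally show ?thesis
    by (simp add: refinement_fiber_left)
qed

lemma minimal_its_quotient:
  fixes \<kappa> :: "'y list \<Rightarrow> 'l"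
  assumes "minimal_sufficient_refinement (restriction sys p) \<kappa>"
  shows "minimal_its (quotient_its \<kappa>) sys p"
proof -
  have "sufficient \<kappa>" "refinement \<kappa> (restriction sys p)"
    using assms by (auto simp: minimal_sufficient_refinement_def)
  \<comment> \<open>The witness in \<open>minimal_its\<close> must have sets of sequences as labels,
    so \<open>fiber \<kappa>\<close> replaces \<open>\<kappa>\<close>; both have the same
    quotient.\<close>
  then have "sufficient (fiber \<kappa>)" "supports (quotient_its \<kappa>) sys p"
    by (simp_all add: sufficient_fiber supports_quotient_iff)
  moreover have "\<not> (\<exists>\<kappa>' :: 'y list \<Rightarrow> 'y list set. sufficient \<kappa>' \<and> strict_refinement (fiber \<kappa>) \<kappa>'
      \<and> supports (quotient_its \<kappa>') sys p)"
    using assms supports_quotient_iff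
    unfolding minimal_sufficient_refinement_def strict_refinement_def
      refinement_fiber_left refinement_fiber_right by blast
  ultimately show ?thesis
    unfolding minimal_its_def using quotient_fiber[symmetric] by blast
qed

text \<open>The Nerode labeling is a competitor in the minimality condition. The labeling behind a
  minimal quotient refines it but not strictly, so the two refine each other.\<close>

lemma fibers_minimal_its:
  fixes \<kappa> :: "'y list \<Rightarrow> 'l"
  assumes "minimal_its (quotient_its \<kappa>) sys p"
  shows "fibers \<kappa> = fibers (nerode (restriction sys p))"
proof -
  let ?n = "nerode (restriction sys p)"
  obtain \<kappa>' :: "'y list \<Rightarrow> 'y list set" where suff: "sufficient \<kappa>'"
    and eq: "quotient_its \<kappa> = quotient_its \<kappa>'"
    and sup: "supports (quotient_its \<kappa>) sys p"
    and min: "\<not> (\<exists>\<kappa>'' :: 'y list \<Rightarrow> 'y list set.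
      sufficient \<kappa>'' \<and> strict_refinement \<kappa>' \<kappa>'' \<and> supports (quotient_its \<kappa>'') sys p)"
    using assms unfolding minimal_its_def by blast
  have "refinement \<kappa>' (restriction sys p)"
    using sup suff by (simp add: eq supports_quotient_iff)
  then have ref: "refinement \<kappa>' ?n"
    by (rule refinement_nerode_if_sufficient[OF suff])
  have "supports (quotient_its (fiber ?n)) sys p"
    by (simp add: quotient_fiber supports_quotient_iff sufficient_nerode refinement_nerode)
  then have "\<not> strict_refinement \<kappa>' (fiber ?n)"
    using min sufficient_nerode sufficient_fiber by blast
  then have "refinement ?n \<kappa>'"
    using ref by (simp add: strict_refinement_def refinement_fiber_left refinement_fiber_right)
  with ref have "fibers \<kappa>' = fibers ?n"
    by (rule fibers_eq_if_mutual_refinement)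
  \<comment> \<open>The states of a quotient are the fibers of its labeling, so equal quotients come
    from equal partitions.\<close>
  moreover have "fibers \<kappa> = fibers \<kappa>'"
    using arg_cong[OF eq, of states] by (simp add: quotient_its_def)
  ultimately show ?thesis
    by simp
qed

theorem corollary1:
  fixes sys :: "('x, 'u, 'y) external_system"
    and task :: "('u, 'y) history \<Rightarrow> bool"
    and pi_hist :: "('u, 'y) policy"
    and pi_bar :: "'y list \<Rightarrow> 'l"
  assumes "feasible sys task pi_hist"
    and "minimal_sufficient_refinement (restriction sys pi_hist) pi_bar"
  shows "minimal_its (quotient_its pi_bar) sys pi_hist \<and>
    (\<forall>(\<kappa>\<^sub>1 :: 'y list \<Rightarrow> 'a) (\<kappa>\<^sub>2 :: 'y list \<Rightarrow> 'b).
       sufficient \<kappa>\<^sub>1 \<longrightarrow> minimal_its (quotient_its \<kappa>\<^sub>1) sys pi_hist \<longrightarrow>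
       sufficient \<kappa>\<^sub>2 \<longrightarrow> minimal_its (quotient_its \<kappa>\<^sub>2) sys pi_hist \<longrightarrow>
       fibers \<kappa>\<^sub>1 = fibers \<kappa>\<^sub>2)"
proof (intro conjI allI impI)
  show "minimal_its (quotient_its pi_bar) sys pi_hist"
    by (rule minimal_its_quotient[OF assms(2)])
next
  fix \<kappa>\<^sub>1 :: "'y list \<Rightarrow> 'a" and \<kappa>\<^sub>2 :: "'y list \<Rightarrow> 'b"
  assume "minimal_its (quotient_its \<kappa>\<^sub>1) sys pi_hist" "minimal_its (quotient_its \<kappa>\<^sub>2) sys pi_hist"
  then show "fibers \<kappa>\<^sub>1 = fibers \<kappa>\<^sub>2"
    \<comment> \<open>Both partitions are the Nerode partition of the restriction, even if the label
      types differ.\<close>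
    by (rule trans[OF fibers_minimal_its fibers_minimal_its[symmetric]])
qed

end
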